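(* Let $\Sigma_1=(X_1,X_{1,0},S_1,U,\to_1,Y,h_1)$ and $\Sigma_2=(X_2,X_{2,0},S_2,U,\to_2,Y,h_2)$ be NTSs with common input set $U$ and output set $Y$. Suppose there exists an InitSOP bisimulation relation $\sim\subseteq X_1\times X_2$ between $\Sigma_1$ and $\Sigma_2$. Then $\Sigma_1$ is initial-state opaque if and only if $\Sigma_2$ is initial-state opaque.
   Context: A nondeterministic transition system (NTS) is a tuple $\Sigma=(X,X_0,S,U,\to,Y,h)$, where $X$ is a (possibly infinite) set of states, $X_0\subseteq X$ the initial states, $S\subseteq X$ the secret states, $U$ a (possibly infinite) set of inputs, $\to\subseteq X\times U\times X$ the transition relation (write $x\xrightarrow{u}x'$ for $(x,u,x')\in\to$), $Y$ a set of outputs and $h:X\to Y$ the output map. $U^*$ is the set of finite sequences $\alpha=\alpha(0)\cdots\alpha(|\alpha|-1)$ over $U$, including the empty one. For $\alpha\in U^*$, a run over $\alpha$ is a nonempty sequence of states $x_0x_1\dots x_k$ with $k\le|\alpha|$, $x_0\in X_0$ and $(x_j,\alpha(j),x_{j+1})\in\to$ for all $j\in\{0,\dots,k-1\}$; it is maximal if $k=|\alpha|$ or there is no $x'$ with $(x_k,\alpha(k),x')\in\to$. $\Sigma$ is initial-state opaque if for every $\alpha\in U^*$ and every maximal run $x_0\dots x_k$ over $\alpha$ with $x_0\in X_0\cap S$, there is a maximal run $x_0'\dots x_k'$ over $\alpha$ with $x_0'\notin S$ and $h(x_j)=h(x_j')$ for all $j\in\{0,\dots,k\}$. A relation $\sim\subseteq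 X_1\times X_2$ is an InitSOP bisimulation relation between $\Sigma_1$ and $\Sigma_2$ if: (1a) for every $x_{1,0}\in X_{1,0}\cap S_1$ there is $x_{2,0}\in X_{2,0}\cap S_2$ with $(x_{1,0},x_{2,0})\in\sim$; (1b) for every $x_{1,0}\in X_{1,0}\setminus S_1$ there is $x_{2,0}\in X_{2,0}\setminus S_2$ with $(x_{1,0},x_{2,0})\in\sim$; (1c) for every $x_{2,0}\in X_{2,0}\cap S_2$ there is $x_{1,0}\in X_{1,0}\cap S_1$ with $(x_{1,0},x_{2,0})\in\sim$; (1d) for every $x_{2,0}\in X_{2,0}\setminus S_2$ there is $x_{1,0}\in X_{1,0}\setminus S_1$ with $(x_{1,0},x_{2,0})\in\sim$; (2) $h_1(x_1)=h_2(x_2)$ for all $(x_1,x_2)\in\sim$; (3a) for every $(x_1,x_2)\in\sim$ and every transition $x_1\xrightarrow{u}_1x_1'$ there is a transition $x_2\xrightarrow{u}_2x_2'$ (same input $u$) with $(x_1',x_2')\in\sim$; (3b) for every $(x_1,x_2)\in\sim$ and every transition $x_2\xrightarrow{u}_2x_2'$ there is a transition $x_1\xrightarrow{u}_1x_1'$ with $(x_1',x_2')\in\sim$. *)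

theory Defs
  imports Main
begin

record ('x, 'u, 'y) transition_system =
  states :: "'x set"
  init :: "'x set"
  secret :: "'x set"
  inputs :: "'u set"
  trans_rel :: "('x \<times> 'u \<times> 'x) set"
  outputs :: "'y set"
  out_map :: "'x \<Rightarrow> 'y"

text \<open>The sets of states, inputs and outputs are explicit carriers, so that the type variables
  impose no restriction on them; values of the output map outside the states are irrelevant.\<close>

definition nts :: "('x, 'u, 'y) transition_system \<Rightarrow> bool" where
  "nts \<Sigma> \<longleftrightarrow>
     init \<Sigma> \<subseteq> states \<Sigma> \<and>
     secret \<Sigma> \<subseteq> states \<Sigma> \<and>
     trans_rel \<Sigma> \<subseteq> states \<Sigma> \<times> inputs \<Sigma> \<times> states \<Sigma> \<and>
     (\<forall>x\<in>states \<Sigma>. out_map \<Sigma> x \<in> outputs \<Sigma>)"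

text \<open>A sequence $x_0 \ldots x_k$ is a list \<open>xs\<close> of length $k + 1$.\<close>

definition run_over :: "('x, 'u, 'y) transition_system \<Rightarrow> 'u list \<Rightarrow> 'x list \<Rightarrow> bool" where
  "run_over \<Sigma> \<alpha> xs \<longleftrightarrow>
     xs \<noteq> [] \<and> set xs \<subseteq> states \<Sigma> \<and> length xs - 1 \<le> length \<alpha> \<and>
     xs ! 0 \<in> init \<Sigma> \<and>
     (\<forall>j < length xs - 1. (xs ! j, \<alpha> ! j, xs ! (j + 1)) \<in> trans_rel \<Sigma>)"

definition maximal_run_over :: "('x, 'u, 'y) transition_system \<Rightarrow> 'u list \<Rightarrow> 'x list \<Rightarrow> bool" where
  "maximal_run_over \<Sigma> \<alpha> xs \<longleftrightarrow>
     run_over \<Sigma> \<alpha> xs \<and>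
     (length xs - 1 = length \<alpha> \<or>
      \<not> (\<exists>x'. (xs ! (length xs - 1), \<alpha> ! (length xs - 1), x') \<in> trans_rel \<Sigma>))"

definition initial_state_opaque :: "('x, 'u, 'y) transition_system \<Rightarrow> bool" where
  "initial_state_opaque \<Sigma> \<longleftrightarrow>
     (\<forall>\<alpha> \<in> lists (inputs \<Sigma>). \<forall>xs.
        maximal_run_over \<Sigma> \<alpha> xs \<and> xs ! 0 \<in> init \<Sigma> \<inter> secret \<Sigma> \<longrightarrow>
        (\<exists>xs'. maximal_run_over \<Sigma> \<alpha> xs' \<and> length xs' = length xs \<and>
               xs' ! 0 \<notin> secret \<Sigma> \<and>
               (\<forall>j < length xs. out_map \<Sigma> (xs ! j) = out_map \<Sigma> (xs' ! j))))"

definition InitSOP_bisimulation ::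
  "('x1, 'u, 'y) transition_system \<Rightarrow> ('x2, 'u, 'y) transition_system \<Rightarrow> ('x1 \<times> 'x2) set \<Rightarrow> bool"
where
  "InitSOP_bisimulation \<Sigma>1 \<Sigma>2 R \<longleftrightarrow>
     R \<subseteq> states \<Sigma>1 \<times> states \<Sigma>2 \<and>
     (\<forall>x1 \<in> init \<Sigma>1 \<inter> secret \<Sigma>1. \<exists>x2 \<in> init \<Sigma>2 \<inter> secret \<Sigma>2. (x1, x2) \<in> R) \<and>
     (\<forall>x1 \<in> init \<Sigma>1 - secret \<Sigma>1. \<exists>x2 \<in> init \<Sigma>2 - secret \<Sigma>2. (x1, x2) \<in> R) \<and>
     (\<forall>x2 \<in> init \<Sigma>2 \<inter> secret \<Sigma>2. \<exists>x1 \<in> init \<Sigma>1 \<inter> secret \<Sigma>1. (x1, x2) \<in> R) \<and>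
     (\<forall>x2 \<in> init \<Sigma>2 - secret \<Sigma>2. \<exists>x1 \<in> init \<Sigma>1 - secret \<Sigma>1. (x1, x2) \<in> R) \<and>
     (\<forall>(x1, x2) \<in> R. out_map \<Sigma>1 x1 = out_map \<Sigma>2 x2) \<and>
     (\<forall>(x1, x2) \<in> R. \<forall>u x1'. (x1, u, x1') \<in> trans_rel \<Sigma>1 \<longrightarrow>
        (\<exists>x2'. (x2, u, x2') \<in> trans_rel \<Sigma>2 \<and> (x1', x2') \<in> R)) \<and>
     (\<forall>(x1, x2) \<in> R. \<forall>u x2'. (x2, u, x2') \<in> trans_rel \<Sigma>2 \<longrightarrow>
        (\<exists>x1'. (x1, u, x1') \<in> trans_rel \<Sigma>1 \<and> (x1', x2') \<in> R))"

end

theory Submission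
  imports Defs
begin

text \<open>Paths lift along a simulation from any partner of their first state. For a bisimulation,
  related states enable the same inputs, so lifting preserves maximality of runs. Opacity of one
  system is then pulled back to the other: lift a secret run, apply opacity there, and lift the
  non-secret witness back along the converse relation.\<close>

definition path_over :: "('x \<times> 'u \<times> 'x) set \<Rightarrow> (nat \<Rightarrow> 'u) \<Rightarrow> 'x list \<Rightarrow> bool" where
  "path_over T w xs \<longleftrightarrow> (\<forall>j < length xs - 1. (xs ! j, w j, xs ! (j + 1)) \<in> T)"

lemma path_over_singleton: "path_over T w [x]"
  by (simp add: path_over_def)

lemma path_over_Cons_Cons:
  "path_over T w (x # x' # xs) \<longleftrightarrow> (x, w 0, x') \<in> T \<and> path_over T (w \<circ> Suc) (x' # xs)"
  by (simp add: path_over_def All_less_Suc2)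

definition simulation ::
  "('x1 \<times> 'u \<times> 'x1) set \<Rightarrow> ('x2 \<times> 'u \<times> 'x2) set \<Rightarrow> ('x1 \<times> 'x2) set \<Rightarrow> bool"
where
  "simulation T1 T2 R \<longleftrightarrow>
     (\<forall>(x, y) \<in> R. \<forall>u x'. (x, u, x') \<in> T1 \<longrightarrow> (\<exists>y'. (y, u, y') \<in> T2 \<and> (x', y') \<in> R))"

lemma simulationE:
  assumes "simulation T1 T2 R" "(x, y) \<in> R" "(x, u, x') \<in> T1"
  obtains y' where "(y, u, y') \<in> T2" "(x', y') \<in> R"
  using assms unfolding simulation_def by blast

lemma path_over_lift:
  assumes sim: "simulation T1 T2 R" and path: "path_over T1 w (x # xs)" and rel: "(x, y) \<in> R"
  obtains ys where "path_over T2 w (y # ys)" "(xs, ys) \<in> listrel R"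
proof -
  have "\<exists>ys. path_over T2 w (y # ys) \<and> (xs, ys) \<in> listrel R"
    using path rel
  proof (induction xs arbitrary: x y w)
    case Nil
    show ?case
      by (intro exI[of _ "[]"]) (simp add: path_over_singleton listrel.Nil)
  next
    case (Cons x' xs)
    from Cons.prems(1) have step: "(x, w 0, x') \<in> T1" and tail: "path_over T1 (w \<circ> Suc) (x' # xs)"
      by (simp_all add: path_over_Cons_Cons)
    obtain y' where y': "(y, w 0, y') \<in> T2" "(x', y') \<in> R"
      using simulationE[OF sim Cons.prems(2) step] .
    obtain ys where "path_over T2 (w \<circ> Suc) (y' # ys)" "(xs, ys) \<in> listrel R"
      using Cons.IH[OF tail y'(2)] by blast
    with y' have "path_over T2 w (y # y' # ys)" "(x' # xs, y' # ys) \<in> listrel R"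
      by (simp_all add: path_over_Cons_Cons listrel.Cons)
    then show ?case by (intro exI conjI)
  qed
  then show thesis using that by blast
qed

lemma listrel_last: "(xs, ys) \<in> listrel R \<Longrightarrow> xs \<noteq> [] \<Longrightarrow> (last xs, last ys) \<in> R"
  by (induction rule: listrel.induct) (auto elim: listrel.cases)

lemma listrel_set_subset_Range: "(xs, ys) \<in> listrel R \<Longrightarrow> set ys \<subseteq> Range R"
  by (induction rule: listrel.induct) auto

lemma listrel_map_eq:
  "(xs, ys) \<in> listrel R \<Longrightarrow> (\<And>x y. (x, y) \<in> R \<Longrightarrow> f x = g y) \<Longrightarrow> map f xs = map g ys"
  by (induction rule: listrel.induct) auto

lemma maximal_run_over_Nil: "\<not> maximal_run_over \<Sigma> \<alpha> []"
  by (simp add: maximal_run_over_def run_over_def)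

lemma maximal_run_over_Cons:
  "maximal_run_over \<Sigma> \<alpha> (x # xs) \<longleftrightarrow>
     x \<in> init \<Sigma> \<and> set (x # xs) \<subseteq> states \<Sigma> \<and> length xs \<le> length \<alpha> \<and>
     path_over (trans_rel \<Sigma>) ((!) \<alpha>) (x # xs) \<and>
     (length xs = length \<alpha> \<or> (\<nexists>x'. (last (x # xs), \<alpha> ! length xs, x') \<in> trans_rel \<Sigma>))"
  by (auto simp: maximal_run_over_def run_over_def path_over_def last_conv_nth)

lemma initial_state_opaque_iff:
  "initial_state_opaque \<Sigma> \<longleftrightarrow>
     (\<forall>\<alpha> \<in> lists (inputs \<Sigma>). \<forall>x xs. maximal_run_over \<Sigma> \<alpha> (x # xs) \<and> x \<in> secret \<Sigma> \<longrightarrow>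
        (\<exists>x' xs'. maximal_run_over \<Sigma> \<alpha> (x' # xs') \<and> x' \<notin> secret \<Sigma> \<and>
                  map (out_map \<Sigma>) (x' # xs') = map (out_map \<Sigma>) (x # xs)))"
proof -
  have all_runs: "(\<forall>xs. maximal_run_over \<Sigma> \<alpha> xs \<and> P xs \<longrightarrow> Q xs) \<longleftrightarrow>
      (\<forall>x xs. maximal_run_over \<Sigma> \<alpha> (x # xs) \<and> P (x # xs) \<longrightarrow> Q (x # xs))" for \<alpha> P Q
    by (metis list.exhaust maximal_run_over_Nil)
  have ex_run: "(\<exists>xs. maximal_run_over \<Sigma> \<alpha> xs \<and> P xs) \<longleftrightarrow>
      (\<exists>x xs. maximal_run_over \<Sigma> \<alpha> (x # xs) \<and> P (x # xs))" for \<alpha> P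
    by (metis list.exhaust maximal_run_over_Nil)
  have same_outputs: "map (out_map \<Sigma>) xs' = map (out_map \<Sigma>) xs \<longleftrightarrow>
      length xs' = length xs \<and> (\<forall>j < length xs. out_map \<Sigma> (xs ! j) = out_map \<Sigma> (xs' ! j))"
    for xs xs'
    by (auto simp: list_eq_iff_nth_eq)
  have initial: "x \<in> init \<Sigma>" if "maximal_run_over \<Sigma> \<alpha> (x # xs)" for \<alpha> x xs
    using that by (simp add: maximal_run_over_Cons)
  show ?thesis
    unfolding initial_state_opaque_def all_runs ex_run same_outputs nth_Cons_0
    using initial by blast
qed

definition output_bisimulation ::
  "('x1, 'u, 'y) transition_system \<Rightarrow> ('x2, 'u, 'y) transition_system \<Rightarrow> ('x1 \<times> 'x2) set \<Rightarrow> bool"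
where
  "output_bisimulation \<Sigma>1 \<Sigma>2 R \<longleftrightarrow>
     R \<subseteq> states \<Sigma>1 \<times> states \<Sigma>2 \<and>
     (\<forall>(x, y) \<in> R. out_map \<Sigma>1 x = out_map \<Sigma>2 y) \<and>
     simulation (trans_rel \<Sigma>1) (trans_rel \<Sigma>2) R \<and>
     simulation (trans_rel \<Sigma>2) (trans_rel \<Sigma>1) (R\<inverse>)"

lemma output_bisimulation_converse:
  "output_bisimulation \<Sigma>1 \<Sigma>2 R \<Longrightarrow> output_bisimulation \<Sigma>2 \<Sigma>1 (R\<inverse>)"
  by (auto simp: output_bisimulation_def)

lemma InitSOP_bisimulation_iff:
  "InitSOP_bisimulation \<Sigma>1 \<Sigma>2 R \<longleftrightarrow>
     output_bisimulation \<Sigma>1 \<Sigma>2 R \<and>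
     init \<Sigma>1 \<inter> secret \<Sigma>1 \<subseteq> R\<inverse> `` (init \<Sigma>2 \<inter> secret \<Sigma>2) \<and>
     init \<Sigma>1 - secret \<Sigma>1 \<subseteq> R\<inverse> `` (init \<Sigma>2 - secret \<Sigma>2) \<and>
     init \<Sigma>2 \<inter> secret \<Sigma>2 \<subseteq> R `` (init \<Sigma>1 \<inter> secret \<Sigma>1) \<and>
     init \<Sigma>2 - secret \<Sigma>2 \<subseteq> R `` (init \<Sigma>1 - secret \<Sigma>1)"
proof -
  have ball_converse: "(\<forall>(y, x) \<in> R\<inverse>. P y x) \<longleftrightarrow> (\<forall>(x, y) \<in> R. P y x)" for P
    by auto
  have subset_Image: "B \<subseteq> R `` A \<longleftrightarrow> (\<forall>b \<in> B. \<exists>a \<in> A. (a, b) \<in> R)"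
    and subset_converse_Image: "A \<subseteq> R\<inverse> `` B \<longleftrightarrow> (\<forall>a \<in> A. \<exists>b \<in> B. (a, b) \<in> R)" for A B
    by blast+
  show ?thesis
    unfolding InitSOP_bisimulation_def output_bisimulation_def simulation_def
      ball_converse subset_Image subset_converse_Image converse_iff
    by (rule iffI; elim conjE; intro conjI)
qed

lemma maximal_run_over_lift:
  assumes bisim: "output_bisimulation \<Sigma>1 \<Sigma>2 R"
    and run: "maximal_run_over \<Sigma>1 \<alpha> (x # xs)" and rel: "(x, y) \<in> R" and init: "y \<in> init \<Sigma>2"
  obtains ys where "maximal_run_over \<Sigma>2 \<alpha> (y # ys)"
    "map (out_map \<Sigma>2) (y # ys) = map (out_map \<Sigma>1) (x # xs)"
proof -
  from bisim have states: "R \<subseteq> states \<Sigma>1 \<times> states \<Sigma>2"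
    and outputs: "\<And>x y. (x, y) \<in> R \<Longrightarrow> out_map \<Sigma>1 x = out_map \<Sigma>2 y"
    and forward: "simulation (trans_rel \<Sigma>1) (trans_rel \<Sigma>2) R"
    and backward: "simulation (trans_rel \<Sigma>2) (trans_rel \<Sigma>1) (R\<inverse>)"
    by (auto simp: output_bisimulation_def)
  obtain ys where path: "path_over (trans_rel \<Sigma>2) ((!) \<alpha>) (y # ys)"
    and tails: "(xs, ys) \<in> listrel R"
    using path_over_lift[OF forward _ rel] run by (auto simp: maximal_run_over_Cons)
  have runs: "(x # xs, y # ys) \<in> listrel R"
    using rel tails by (rule listrel.Cons)
  have len: "length ys = length xs"
    using listrel_eq_len[OF tails] by simp
  have "set (y # ys) \<subseteq> states \<Sigma>2"
    using listrel_set_subset_Range[OF runs] states by blast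
  moreover have "\<exists>x'. (last (x # xs), u, x') \<in> trans_rel \<Sigma>1"
    if "(last (y # ys), u, y') \<in> trans_rel \<Sigma>2" for u y'
    using simulationE[OF backward _ that] listrel_last[OF runs] by blast
  ultimately have "maximal_run_over \<Sigma>2 \<alpha> (y # ys)"
    using run path init len unfolding maximal_run_over_Cons by metis
  moreover have "map (out_map \<Sigma>2) (y # ys) = map (out_map \<Sigma>1) (x # xs)"
    using listrel_map_eq[OF runs outputs] by (rule sym)
  ultimately show thesis by (rule that)
qed

lemma initial_state_opaque_pullback:
  assumes bisim: "output_bisimulation \<Sigma>1 \<Sigma>2 R" and inputs: "inputs \<Sigma>1 \<subseteq> inputs \<Sigma>2"
    and secret: "init \<Sigma>1 \<inter> secret \<Sigma>1 \<subseteq> R\<inverse> `` (init \<Sigma>2 \<inter> secret \<Sigma>2)"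
    and nonsecret: "init \<Sigma>2 - secret \<Sigma>2 \<subseteq> R `` (init \<Sigma>1 - secret \<Sigma>1)"
    and opaque: "initial_state_opaque \<Sigma>2"
  shows "initial_state_opaque \<Sigma>1"
  unfolding initial_state_opaque_iff
proof (intro ballI allI impI, elim conjE)
  fix \<alpha> x xs
  assume \<alpha>: "\<alpha> \<in> lists (inputs \<Sigma>1)" and run: "maximal_run_over \<Sigma>1 \<alpha> (x # xs)"
    and x: "x \<in> secret \<Sigma>1"
  obtain y where y: "(x, y) \<in> R" "y \<in> init \<Sigma>2" "y \<in> secret \<Sigma>2"
    using secret run x by (auto simp: maximal_run_over_Cons)
  obtain ys where ys: "maximal_run_over \<Sigma>2 \<alpha> (y # ys)"
    "map (out_map \<Sigma>2) (y # ys) = map (out_map \<Sigma>1) (x # xs)"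
    using maximal_run_over_lift[OF bisim run y(1,2)] .
  obtain y' ys' where ys': "maximal_run_over \<Sigma>2 \<alpha> (y' # ys')" "y' \<notin> secret \<Sigma>2"
    "map (out_map \<Sigma>2) (y' # ys') = map (out_map \<Sigma>2) (y # ys)"
    using opaque \<alpha> lists_mono[OF inputs] ys(1) y(3) unfolding initial_state_opaque_iff by blast
  obtain x' where x': "(y', x') \<in> R\<inverse>" "x' \<in> init \<Sigma>1" "x' \<notin> secret \<Sigma>1"
    using nonsecret ys'(1,2) by (auto simp: maximal_run_over_Cons)
  obtain xs' where "maximal_run_over \<Sigma>1 \<alpha> (x' # xs')"
    "map (out_map \<Sigma>1) (x' # xs') = map (out_map \<Sigma>2) (y' # ys')"
    using maximal_run_over_lift[OF output_bisimulation_converse[OF bisim] ys'(1) x'(1,2)] .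
  with x'(3) ys(2) ys'(3)
  show "\<exists>x' xs'. maximal_run_over \<Sigma>1 \<alpha> (x' # xs') \<and> x' \<notin> secret \<Sigma>1 \<and>
      map (out_map \<Sigma>1) (x' # xs') = map (out_map \<Sigma>1) (x # xs)"
    by metis
qed

theorem theorem3p14:
  fixes \<Sigma>1 :: "('x1, 'u, 'y) transition_system"
    and \<Sigma>2 :: "('x2, 'u, 'y) transition_system"
  assumes "nts \<Sigma>1" and "nts \<Sigma>2"
    and "inputs \<Sigma>1 = inputs \<Sigma>2" and "outputs \<Sigma>1 = outputs \<Sigma>2"
    and "\<exists>R. InitSOP_bisimulation \<Sigma>1 \<Sigma>2 R"
  shows "initial_state_opaque \<Sigma>1 \<longleftrightarrow> initial_state_opaque \<Sigma>2"
proof -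
  obtain R where bisim: "output_bisimulation \<Sigma>1 \<Sigma>2 R"
    and matching: "init \<Sigma>1 \<inter> secret \<Sigma>1 \<subseteq> R\<inverse> `` (init \<Sigma>2 \<inter> secret \<Sigma>2)"
      "init \<Sigma>1 - secret \<Sigma>1 \<subseteq> R\<inverse> `` (init \<Sigma>2 - secret \<Sigma>2)"
      "init \<Sigma>2 \<inter> secret \<Sigma>2 \<subseteq> R `` (init \<Sigma>1 \<inter> secret \<Sigma>1)"
      "init \<Sigma>2 - secret \<Sigma>2 \<subseteq> R `` (init \<Sigma>1 - secret \<Sigma>1)"
    using assms(5) unfolding InitSOP_bisimulation_iff by blast
  show ?thesis
  proof
    assume "initial_state_opaque \<Sigma>1"
    then show "initial_state_opaque \<Sigma>2"
      using initial_state_opaque_pullback[OF output_bisimulation_converse[OF bisim]] assms(3) matching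
      by simp
  next
    assume "initial_state_opaque \<Sigma>2"
    then show "initial_state_opaque \<Sigma>1"
      using initial_state_opaque_pullback[OF bisim] assms(3) matching by simp
  qed
qed

end
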